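(* Let $r\ge 1$, let $-1 \leq \alpha < \beta_1 < \cdots < \beta_r \leq 1$, and let $s_i = [\alpha,\beta_i]$ for $i\in\{1,\ldots,r\}$. Then the set $\{s_1,\ldots,s_r\}$ is unisolvent for $\mathbb{P}_{r-1}$, and the polynomials $$\ell_{s_j}(x) = \ell_{\beta_j}'(x), \quad j\in\{1,\ldots,r\},$$ form a cardinal Lagrange basis of $\mathbb{P}_{r-1}$ with respect to $\{s_1,\ldots,s_r\}$, i.e. they form a basis of $\mathbb{P}_{r-1}$ and satisfy $\int_{s_i}\ell_{s_j}(x)\,\mathrm{d}x=\delta_{ij}$ for all $i,j\in\{1,\ldots,r\}$.
   Context: $\mathbb{P}_{n}$ denotes the space of real univariate polynomials of degree at most $n$. A set of $r$ segments $\{s_1,\ldots,s_r\}$ (nondegenerate closed intervals contained in $[-1,1]$) is called unisolvent for $\mathbb{P}_{r-1}$ if for every $(\mu_1,\ldots,\mu_r)\in\mathbb{R}^r$ there is a unique $p\in\mathbb{P}_{r-1}$ with $\int_{s_i} p(x)\,\mathrm{d}x = \mu_i$ for all $i$. The polynomials $\ell_\alpha,\ell_{\beta_1},\ldots,\ell_{\beta_r}\in\mathbb{P}_r$ are the nodal Lagrange basis for the $r+1$ nodes $\{\alpha,\beta_1,\ldots,\beta_r\}$; that is, $\ell_{\beta_j}(\beta_i)=\delta_{ij}$ and $\ell_{\beta_j}(\alpha)=0$ for $i,j\in\{1,\ldots,r\}$. $\ell_{\beta_j}'$ is the derivative of $\ell_{\beta_j}$. *)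

theory Defs
  imports "HOL-Analysis.Analysis" "HOL-Computational_Algebra.Polynomial"
begin

definition polys_upto :: "nat \<Rightarrow> real poly set" where
  "polys_upto n = {p. degree p \<le> n}"

text \<open>Type \<^typ>\<open>real poly\<close> is not an instance of class \<^class>\<open>real_vector\<close>,
  so linear independence and span come from the locale, with \<^const>\<open>smult\<close> as scaling.\<close>

global_interpretation real_poly: vector_space "smult :: real \<Rightarrow> real poly \<Rightarrow> real poly"
  by unfold_locales (simp_all add: smult_add_right smult_add_left)

text \<open>Families of \<open>r\<close> objects are functions on \<^typ>\<open>nat\<close> of which only the
  values at \<open>1, \<dots>, r\<close> matter; in particular vectors of \<open>r\<close> reals are such functions.\<close>

definition segment :: "real set \<Rightarrow> bool" where
  "segment s \<longleftrightarrow> (\<exists>a b. -1 \<le> a \<and> a < b \<and> b \<le> 1 \<and> s = {a..b})"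

text \<open>Injectivity expresses that \<open>{s 1, \<dots>, s r}\<close> is a set of \<open>r\<close> segments.
  Meant for \<open>r \<ge> 1\<close>, since \<open>r - 1\<close> is truncated subtraction.\<close>

definition unisolvent :: "nat \<Rightarrow> (nat \<Rightarrow> real set) \<Rightarrow> bool" where
  "unisolvent r s \<longleftrightarrow>
     (\<forall>i\<in>{1..r}. segment (s i)) \<and> inj_on s {1..r} \<and>
     (\<forall>\<mu> :: nat \<Rightarrow> real. \<exists>!p. p \<in> polys_upto (r - 1) \<and>
        (\<forall>i\<in>{1..r}. integral (s i) (poly p) = \<mu> i))"

definition family_basis :: "nat \<Rightarrow> (nat \<Rightarrow> real poly) \<Rightarrow> real poly set \<Rightarrow> bool" where
  "family_basis r b V \<longleftrightarrow>
     inj_on b {1..r} \<and> real_poly.independent (b ` {1..r}) \<and> real_poly.span (b ` {1..r}) = V"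

definition cardinal_lagrange_basis ::
    "nat \<Rightarrow> (nat \<Rightarrow> real set) \<Rightarrow> (nat \<Rightarrow> real poly) \<Rightarrow> bool" where
  "cardinal_lagrange_basis r s b \<longleftrightarrow>
     family_basis r b (polys_upto (r - 1)) \<and>
     (\<forall>i\<in>{1..r}. \<forall>j\<in>{1..r}. integral (s i) (poly (b j)) = (if i = j then 1 else 0))"

text \<open>Lagrange polynomials are indexed by their node: \<open>l x\<close> belongs to \<open>x \<in> X\<close>.\<close>

definition nodal_lagrange_basis :: "real set \<Rightarrow> (real \<Rightarrow> real poly) \<Rightarrow> bool" where
  "nodal_lagrange_basis X l \<longleftrightarrow>
     (\<forall>x\<in>X. l x \<in> polys_upto (card X - 1) \<and>
        (\<forall>y\<in>X. poly (l x) y = (if x = y then 1 else 0)))"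

lemma nodal_lagrange_basis_exists:
  assumes "finite X"
  shows "\<exists>l. nodal_lagrange_basis X l"
proof -
  define l where "l = (\<lambda>x. \<Prod>y\<in>X - {x}. smult (1 / (x - y)) [:- y, 1:])"
  have "nodal_lagrange_basis X l"
    unfolding nodal_lagrange_basis_def polys_upto_def
  proof (intro ballI conjI CollectI)
    fix x assume x: "x \<in> X"
    have "degree (l x) \<le> (\<Sum>y\<in>X - {x}. degree (smult (1 / (x - y)) [:- y, 1:]))"
      unfolding l_def
      using degree_prod_sum_le[of "X - {x}" "\<lambda>y. smult (1 / (x - y)) [:- y, 1:]"] assms
      unfolding o_def by blast
    also have "\<dots> \<le> (\<Sum>y\<in>X - {x}. 1)"
      by (intro sum_mono) simp
    also have "\<dots> = card X - 1"
      using assms x by simp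
    finally show "degree (l x) \<le> card X - 1" .
    fix y assume y: "y \<in> X"
    show "poly (l x) y = (if x = y then 1 else 0)"
    proof (cases "x = y")
      case True
      then show ?thesis
        unfolding l_def poly_prod by (auto intro!: prod.neutral simp flip: diff_divide_distrib)
    next
      case False
      then show ?thesis
        unfolding l_def poly_prod using assms y by (auto intro!: prod_zero bexI[of _ y])
    qed
  qed
  then show ?thesis by blast
qed

lemma nodal_lagrange_basis_unique:
  assumes "finite X" "nodal_lagrange_basis X l" "nodal_lagrange_basis X l'" "x \<in> X"
  shows "l x = l' x"
proof (rule poly_eqI_degree[where A = X])
  have "card X > 0" using assms by (auto simp: card_gt_0_iff)
  then show "card X > degree (l x)" "card X > degree (l' x)"
    using assms by (fastforce simp: nodal_lagrange_basis_def polys_upto_def)+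
qed (use assms in \<open>auto simp: nodal_lagrange_basis_def\<close>)

end

theory Submission
  imports Defs
begin

text \<open>By the fundamental theorem of calculus, integrating a polynomial over \<open>[\<alpha>, \<beta> i]\<close> amounts to
  evaluating its antiderivative \<open>P\<close> with \<open>P \<alpha> = 0\<close> at \<open>\<beta> i\<close>. Antidifferentiation identifies
  polynomials of degree at most \<open>r - 1\<close> with polynomials of degree at most \<open>r\<close> vanishing at \<open>\<alpha>\<close>, so
  integration data on segments with common left end \<open>\<alpha>\<close> are the same as nodal data at the nodes
  \<open>\<beta> 1, \<dots>, \<beta> r\<close>.

  This is used twice. If all integrals of \<open>p\<close> vanish, its antiderivative has \<open>r + 1\<close> zeros and degree
  at most \<open>r\<close>, hence \<open>p = 0\<close> (\<open>poly_eq_0_if_integrals_eq_0\<close>). And the nodal polynomial of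
  \<open>\<beta> j\<close> already vanishes at \<open>\<alpha>\<close>, so its derivative has integrals \<open>\<delta>\<^sub>i\<^sub>j\<close>. The rest is duality
  (\<open>cardinal_lagrange_basis_if_dual\<close>): functionals that separate the points of a space, together
  with a dual family in that space, make the interpolation problem uniquely solvable and the
  family a basis.\<close>

lemma integral_poly_pderiv:
  fixes p :: "real poly"
  assumes "a \<le> b"
  shows "integral {a..b} (poly (pderiv p)) = poly p b - poly p a"
  using assms
  by (intro integral_unique fundamental_theorem_of_calculus)
     (auto simp flip: has_real_derivative_iff_has_vector_derivative
           intro: DERIV_subset[OF poly_DERIV])

lemma ex_poly_antiderivative:
  fixes q :: "'a :: field_char_0 poly"
  shows "\<exists>p. pderiv p = q"
proof
  show "pderiv (\<Sum>i\<le>degree q. monom (coeff q i / of_nat (Suc i)) (Suc i)) = q"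
  proof (rule poly_eqI)
    fix n
    have "coeff (\<Sum>i\<le>degree q. monom (coeff q i / of_nat (Suc i)) (Suc i)) (Suc n)
        = (\<Sum>i\<le>degree q. if i = n then coeff q n / of_nat (Suc n) else 0)"
      unfolding coeff_sum by (intro sum.cong) (auto simp: coeff_monom)
    also have "\<dots> = coeff q n / of_nat (Suc n)"
      by (simp add: coeff_eq_0)
    finally show "coeff (pderiv (\<Sum>i\<le>degree q. monom (coeff q i / of_nat (Suc i)) (Suc i))) n
        = coeff q n"
      by (simp add: coeff_pderiv del: of_nat_Suc)
  qed
qed

text \<open>The antiderivative takes the same value at every node, so it has more nodes of equal value
  than its degree allows unless it is constant.\<close>

lemma poly_eq_0_if_integrals_eq_0:
  fixes p :: "real poly"
  assumes "finite B" "degree p < card B"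
    and "\<And>b. b \<in> B \<Longrightarrow> a < b"
    and "\<And>b. b \<in> B \<Longrightarrow> integral {a..b} (poly p) = 0"
  shows "p = 0"
proof -
  obtain P where P: "pderiv P = p"
    using ex_poly_antiderivative by blast
  have deg: "degree P \<le> Suc (degree p)"
    using degree_pderiv[of P] P by simp
  have "a \<notin> B"
    using assms(3) by blast
  then have card: "card (insert a B) = Suc (card B)"
    using assms(1) by simp
  have "P = [:poly P a:]"
  proof (rule poly_eqI_degree[where A = "insert a B"])
    fix x assume "x \<in> insert a B"
    then show "poly P x = poly [:poly P a:] x"
      using assms(3,4) integral_poly_pderiv[of a x P] P by force
  qed (use deg card assms(2) in auto)
  then have "pderiv P = 0"
    by (metis pderiv_singleton)
  then show ?thesis
    using P by simp
qed

lemma subspace_polys_upto: "real_poly.subspace (polys_upto n)"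
  unfolding real_poly.subspace_def polys_upto_def
  by (auto intro: degree_add_le order_trans[OF degree_smult_le])

lemma integral_poly_lincomb:
  assumes "segment t" "finite A"
  shows "integral t (poly (\<Sum>j\<in>A. smult (c j) (b j))) = (\<Sum>j\<in>A. c j * integral t (poly (b j)))"
proof -
  have int: "poly q integrable_on t" for q
    using assms(1) by (auto simp: segment_def intro!: integrable_continuous_real continuous_intros)
  have "integral t (poly (\<Sum>j\<in>A. smult (c j) (b j)))
      = integral t (\<lambda>x. \<Sum>j\<in>A. c j * poly (b j) x)"
    by (rule arg_cong[where f = "integral t"]) (simp add: poly_sum fun_eq_iff)
  also have "\<dots> = (\<Sum>j\<in>A. c j * integral t (poly (b j)))"
    using assms(2) int by (subst integral_sum) (auto intro!: integrable_on_mult_right)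
  finally show ?thesis .
qed

text \<open>Both conclusions rest on one fact: the combination \<open>\<Sum>j. c j \<cdot> b j\<close> has \<open>i\<close>-th integral
  \<open>c i\<close>. So prescribed integrals are attained by using them as coefficients, a vanishing
  combination has zero coefficients, and every \<open>p\<close> agrees with the combination having its own
  integrals as coefficients, because the integrals separate polynomials.\<close>

lemma cardinal_lagrange_basis_if_dual:
  assumes seg: "\<And>i. i \<in> {1..r} \<Longrightarrow> segment (s i)" and inj: "inj_on s {1..r}"
    and sep: "\<And>p. p \<in> polys_upto (r - 1) \<Longrightarrow> (\<And>i. i \<in> {1..r} \<Longrightarrow> integral (s i) (poly p) = 0)
      \<Longrightarrow> p = 0"
    and mem: "\<And>j. j \<in> {1..r} \<Longrightarrow> b j \<in> polys_upto (r - 1)"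
    and dual: "\<And>i j. i \<in> {1..r} \<Longrightarrow> j \<in> {1..r} \<Longrightarrow>
      integral (s i) (poly (b j)) = (if i = j then 1 else 0)"
  shows "unisolvent r s" "cardinal_lagrange_basis r s b"
proof -
  define comb where "comb c = (\<Sum>j\<in>{1..r}. smult (c j) (b j))" for c
  have comb_mem: "comb c \<in> polys_upto (r - 1)" for c
    unfolding comb_def using mem
    by (intro real_poly.subspace_sum real_poly.subspace_scale subspace_polys_upto) auto
  have integral_comb: "integral (s i) (poly (comb c)) = c i" if "i \<in> {1..r}" for c i
    unfolding comb_def using that by (simp add: integral_poly_lincomb seg dual if_distrib cong: if_cong)
  have eqI: "p = q" if pq: "p \<in> polys_upto (r - 1)" "q \<in> polys_upto (r - 1)"
    and eq: "\<And>i. i \<in> {1..r} \<Longrightarrow> integral (s i) (poly p) = integral (s i) (poly q)" for p q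
  proof -
    have "integral (s i) (poly (p - q)) = 0" if "i \<in> {1..r}" for i
    proof -
      have "poly f integrable_on s i" for f
        using seg[OF that]
        by (auto simp: segment_def intro!: integrable_continuous_real continuous_intros)
      then show ?thesis
        using eq[OF that] by (simp add: poly_diff[abs_def] integral_diff)
    qed
    then have "p - q = 0"
      using pq by (intro sep real_poly.subspace_diff subspace_polys_upto)
    then show ?thesis by simp
  qed
  show "unisolvent r s"
    unfolding unisolvent_def
  proof (intro conjI allI ballI seg inj)
    fix \<mu> :: "nat \<Rightarrow> real"
    show "\<exists>!p. p \<in> polys_upto (r - 1) \<and> (\<forall>i\<in>{1..r}. integral (s i) (poly p) = \<mu> i)"
      using comb_mem integral_comb by (intro ex1I[of _ "comb \<mu>"]) (auto intro: eqI)
  qed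
  have inj_b: "inj_on b {1..r}"
    using dual by (intro inj_onI) (metis zero_neq_one)
  have "real_poly.independent (b ` {1..r})"
  proof (rule real_poly.independent_if_scalars_zero)
    fix f x assume "(\<Sum>x\<in>b ` {1..r}. smult (f x) x) = 0" and x: "x \<in> b ` {1..r}"
    then have "comb (f \<circ> b) = 0"
      using inj_b by (simp add: comb_def sum.reindex)
    then show "f x = 0"
      using x integral_comb[of _ "f \<circ> b"] by (auto simp: poly_0[abs_def])
  qed simp
  moreover have "real_poly.span (b ` {1..r}) = polys_upto (r - 1)"
  proof
    show "real_poly.span (b ` {1..r}) \<subseteq> polys_upto (r - 1)"
      using mem by (intro real_poly.span_minimal subspace_polys_upto) auto
    show "polys_upto (r - 1) \<subseteq> real_poly.span (b ` {1..r})"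
    proof
      fix p assume "p \<in> polys_upto (r - 1)"
      then have "p = comb (\<lambda>i. integral (s i) (poly p))"
        by (intro eqI comb_mem) (simp_all add: integral_comb)
      also have "\<dots> \<in> real_poly.span (b ` {1..r})"
        unfolding comb_def
        by (intro real_poly.span_sum real_poly.span_scale real_poly.span_base) auto
      finally show "p \<in> real_poly.span (b ` {1..r})" .
    qed
  qed
  ultimately show "cardinal_lagrange_basis r s b"
    unfolding cardinal_lagrange_basis_def family_basis_def using inj_b dual by blast
qed

theorem proposition3p6:
  fixes r :: nat and \<alpha> :: real and \<beta> :: "nat \<Rightarrow> real"
    and s :: "nat \<Rightarrow> real set" and l :: "real \<Rightarrow> real poly"
  assumes "r \<ge> 1"
    and "-1 \<le> \<alpha>" and "\<alpha> < \<beta> 1" and "strict_mono_on {1..r} \<beta>" and "\<beta> r \<le> 1"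
    and "\<And>i. i \<in> {1..r} \<Longrightarrow> s i = {\<alpha>..\<beta> i}"
    and "nodal_lagrange_basis ({\<alpha>} \<union> \<beta> ` {1..r}) l"
  shows "unisolvent r s \<and> cardinal_lagrange_basis r s (\<lambda>j. pderiv (l (\<beta> j)))"
proof -
  have mono: "\<beta> i \<le> \<beta> j" if "i \<in> {1..r}" "j \<in> {1..r}" "i \<le> j" for i j
    using strict_mono_on_leD[OF assms(4)] that by blast
  have gt: "\<alpha> < \<beta> i" and le: "\<beta> i \<le> 1" if "i \<in> {1..r}" for i
    using mono[of 1 i] mono[of i r] that assms(1,3,5) by auto
  have inj: "inj_on \<beta> {1..r}"
    using assms(4) by (rule strict_mono_on_imp_inj_on)
  have "\<alpha> \<notin> \<beta> ` {1..r}"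
    using gt by force
  then have card: "card ({\<alpha>} \<union> \<beta> ` {1..r}) = Suc r"
    using inj by (simp add: card_image)
  have deg: "degree (l (\<beta> j)) \<le> r" if "j \<in> {1..r}" for j
    using assms(7) that card by (auto simp: nodal_lagrange_basis_def polys_upto_def)
  have nodal: "poly (l (\<beta> j)) x = (if \<beta> j = x then 1 else 0)"
    if "j \<in> {1..r}" "x \<in> {\<alpha>} \<union> \<beta> ` {1..r}" for j x
    using assms(7) that unfolding nodal_lagrange_basis_def by blast
  have seg: "segment (s i)" if "i \<in> {1..r}" for i
    using gt[OF that] le[OF that] assms(2,6) that unfolding segment_def by blast
  have inj_s: "inj_on s {1..r}"
  proof (rule inj_onI)
    fix i j assume ij: "i \<in> {1..r}" "j \<in> {1..r}" "s i = s j"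
    then have "\<beta> i = \<beta> j"
      using gt[of i] assms(6) by (simp add: Icc_eq_Icc)
    then show "i = j"
      using inj ij by (auto dest: inj_onD)
  qed
  have sep: "p = 0" if p: "p \<in> polys_upto (r - 1)"
    and int: "\<And>i. i \<in> {1..r} \<Longrightarrow> integral (s i) (poly p) = 0" for p
  proof (rule poly_eq_0_if_integrals_eq_0[of "\<beta> ` {1..r}" p \<alpha>])
    show "degree p < card (\<beta> ` {1..r})"
      using p assms(1) inj by (simp add: polys_upto_def card_image)
  qed (use gt int assms(6) in auto)
  have mem: "pderiv (l (\<beta> j)) \<in> polys_upto (r - 1)" if "j \<in> {1..r}" for j
    using deg[OF that] by (simp add: polys_upto_def degree_pderiv)
  have dual: "integral (s i) (poly (pderiv (l (\<beta> j)))) = (if i = j then 1 else 0)"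
    if ij: "i \<in> {1..r}" "j \<in> {1..r}" for i j
  proof -
    have "integral (s i) (poly (pderiv (l (\<beta> j)))) = poly (l (\<beta> j)) (\<beta> i) - poly (l (\<beta> j)) \<alpha>"
      using integral_poly_pderiv[of \<alpha> "\<beta> i"] gt[OF ij(1)] assms(6) ij by simp
    also have "\<dots> = (if i = j then 1 else 0)"
      using nodal[OF ij(2)] gt[OF ij(2)] ij inj by (auto dest: inj_onD)
    finally show ?thesis .
  qed
  show ?thesis
    using cardinal_lagrange_basis_if_dual[OF seg inj_s sep mem dual] by blast
qed

end
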